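(* Let $m\in\mathbb{N}$, let $\alpha_j,\beta_j,\gamma,b,c\in\mathbb{C}$ $(j=1,\dots,m)$ and let $\kappa>0$ be real, with $\sum_{j=1}^m\Re(\alpha_j)>\max\{0,\kappa-1\}$, $\Re(\beta_j)>0$ for all $j$, and $\Re(\gamma)>0$. Let $\lambda,\delta\in\mathbb{C}$ with $\Re(\lambda)>0$ and $\Re(\delta)>0$. Then for every $x>0$, $$\left(I_{0+}^{\lambda}\left\{t^{\delta-1}\mathcal{J}_{(\beta_j)_m,\kappa,b}^{(\alpha_j)_m,\gamma,c}(t)\right\}\right)(x)=\frac{x^{\lambda+\delta-1}}{\Gamma(\gamma)}\;{}_2\Psi_{m+1}\left[\begin{array}{c}(\gamma,\kappa),(\delta,1)\\ \left(\beta_j+\frac{b+1}{2},\alpha_j\right)_{j=1}^m,(\lambda+\delta,1)\end{array}\Big|\;cx\right].$$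
   Context: The generalized multiindex Bessel function is $$\mathcal{J}_{(\beta_j)_m,\kappa,b}^{(\alpha_j)_m,\gamma,c}[z]=\sum_{n=0}^\infty\frac{c^n(\gamma)_{\kappa n}}{\prod_{j=1}^m\Gamma\left(\alpha_jn+\beta_j+\frac{b+1}{2}\right)}\frac{z^n}{n!},\qquad (\gamma)_{\nu}=\frac{\Gamma(\gamma+\nu)}{\Gamma(\gamma)}.$$ The Fox–Wright function is given by the series $${}_p\Psi_q\left[\begin{array}{c}(a_1,A_1),\dots,(a_p,A_p)\\(b_1,B_1),\dots,(b_q,B_q)\end{array}\Big|\;z\right]=\sum_{n=0}^\infty\frac{\Gamma(a_1+A_1n)\cdots\Gamma(a_p+A_pn)}{\Gamma(b_1+B_1n)\cdots\Gamma(b_q+B_qn)}\frac{z^n}{n!},$$ where some of the $B_j$ may be complex (here $B_j=\alpha_j$). Throughout, $1/\Gamma$ is the entire reciprocal Gamma function, with value $0$ at the poles of $\Gamma$. The notation $\left(\beta_j+\frac{b+1}{2},\alpha_j\right)_{j=1}^m$ stands for the list of the $m$ pairs $\left(\beta_j+\frac{b+1}{2},\alpha_j\right)$. The left-sided Riemann–Liouville fractional integral is, for $\Re(\lambda)>0$ and $x>0$, $$(I_{0+}^\lambda f)(x)=\frac{1}{\Gamma(\lambda)}\int_0^x\frac{f(t)}{(x-t)^{1-\lambda}}\,dt.$$ *)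

theory Defs
  imports "HOL-Analysis.Analysis"
begin

text \<open>
  The symbol \<open>(g)\<^sub>v = \<Gamma>(g + v) / \<Gamma>(g)\<close> for arbitrary complex \<open>v\<close>;
  the library constant \<^const>\<open>pochhammer\<close> only covers \<open>v \<in> \<nat>\<close>.
\<close>
definition gen_pochhammer :: "complex \<Rightarrow> complex \<Rightarrow> complex" where
  "gen_pochhammer g v = Gamma (g + v) / Gamma g"

text \<open>
  Reciprocals of Gamma values in denominators are written with \<^const>\<open>rGamma\<close>, the entire
  function \<open>1/\<Gamma>\<close>. Only the values \<open>\<alpha> j, \<beta> j\<close> with \<open>1 \<le> j \<le> m\<close> are used.
\<close>
definition multiindex_bessel_term ::
    "nat \<Rightarrow> (nat \<Rightarrow> complex) \<Rightarrow> (nat \<Rightarrow> complex) \<Rightarrow> complex \<Rightarrow> real \<Rightarrow> complex \<Rightarrow> complex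
      \<Rightarrow> complex \<Rightarrow> nat \<Rightarrow> complex" where
  "multiindex_bessel_term m \<alpha> \<beta> \<gamma> \<kappa> b c z n =
     c ^ n * gen_pochhammer \<gamma> (of_real \<kappa> * of_nat n)
       * (\<Prod>j=1..m. rGamma (\<alpha> j * of_nat n + \<beta> j + (b + 1) / 2))
       * (z ^ n / fact n)"

definition multiindex_bessel ::
    "nat \<Rightarrow> (nat \<Rightarrow> complex) \<Rightarrow> (nat \<Rightarrow> complex) \<Rightarrow> complex \<Rightarrow> real \<Rightarrow> complex \<Rightarrow> complex
      \<Rightarrow> complex \<Rightarrow> complex" where
  "multiindex_bessel m \<alpha> \<beta> \<gamma> \<kappa> b c z = (\<Sum>n. multiindex_bessel_term m \<alpha> \<beta> \<gamma> \<kappa> b c z n)"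

text \<open>
  The two lists contain the pairs \<open>(a\<^sub>i, A\<^sub>i)\<close> and \<open>(b\<^sub>j, B\<^sub>j)\<close>;
  their lengths are \<open>p\<close> and \<open>q\<close>.
\<close>
definition fox_wright_term ::
    "(complex \<times> complex) list \<Rightarrow> (complex \<times> complex) list \<Rightarrow> complex \<Rightarrow> nat \<Rightarrow> complex" where
  "fox_wright_term as bs z n =
     (\<Prod>(a, A)\<leftarrow>as. Gamma (a + A * of_nat n)) * (\<Prod>(b, B)\<leftarrow>bs. rGamma (b + B * of_nat n))
       * (z ^ n / fact n)"

definition fox_wright ::
    "(complex \<times> complex) list \<Rightarrow> (complex \<times> complex) list \<Rightarrow> complex \<Rightarrow> complex" where
  "fox_wright as bs z = (\<Sum>n. fox_wright_term as bs z n)"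

definition rl_integrand :: "complex \<Rightarrow> (real \<Rightarrow> complex) \<Rightarrow> real \<Rightarrow> real \<Rightarrow> complex" where
  "rl_integrand \<mu> f x t = f t / of_real (x - t) powr (1 - \<mu>)"

text \<open>
  The left-sided Riemann--Liouville integral of complex order \<open>\<mu>\<close> is taken in the sense of
  Lebesgue. Since the Bochner integral is total, existence is a separate predicate.
\<close>
definition rl_integrable :: "complex \<Rightarrow> (real \<Rightarrow> complex) \<Rightarrow> real \<Rightarrow> bool" where
  "rl_integrable \<mu> f x \<longleftrightarrow> set_integrable lborel {0<..<x} (rl_integrand \<mu> f x)"

definition rl_integral :: "complex \<Rightarrow> (real \<Rightarrow> complex) \<Rightarrow> real \<Rightarrow> complex" where
  "rl_integral \<mu> f x = 1 / Gamma \<mu> * (LINT t:{0<..<x}|lborel. rl_integrand \<mu> f x t)"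

end

theory Submission
  imports Defs "HOL-Real_Asymp.Real_Asymp"
begin

text \<open>
  Up to factors \<open>exp (O(n))\<close>, \<open>\<bar>\<Gamma>(\<gamma> + \<kappa> n)\<bar>\<close> is at most \<open>n\<close> to the power \<open>\<kappa> n\<close> and
  \<open>\<bar>1/\<Gamma>(\<alpha> n + \<beta>)\<bar>\<close> is at most \<open>n\<close> to the power \<open>- Re \<alpha> n\<close>, for every complex \<open>\<alpha>\<close>: to the right of
  the line \<open>Re z = 1/2\<close> a rotation into the complex plane costs only \<open>exp (\<pi> \<bar>Im z\<bar> / 2)\<close>, and to the
  left the reflection formula applies. Hence only the sum of the \<open>Re (\<alpha> j)\<close> matters, and the Bessel
  series converges absolutely everywhere. Termwise integration then reduces the claim to the Beta
  integral with complex exponents, which follows by computing the convolution of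
  \<open>t powr (a - 1) * exp (- t)\<close> and \<open>t powr (b - 1) * exp (- t)\<close>.
\<close>

section \<open>Growth of the Gamma function along arithmetic progressions\<close>

text \<open>The bound reads \<open>n\<close> to the power \<open>a * n\<close>, times
  \<open>exp (C * n)\<close>. Since \<open>C\<close> is existential, every factor of exponential
  size is absorbed and only the order \<open>a\<close> has to be tracked.\<close>

definition superexp_bound :: "real \<Rightarrow> (nat \<Rightarrow> 'a::real_normed_vector) \<Rightarrow> bool" where
  "superexp_bound a f \<longleftrightarrow>
     (\<exists>C. \<forall>\<^sub>F n in sequentially. norm (f n) \<le> exp (a * (real n * ln (real n)) + C * real n))"

lemma superexp_boundI:
  assumes "\<forall>\<^sub>F n in sequentially. norm (f n) \<le> exp (a * (real n * ln (real n)) + C * real n)"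
  shows "superexp_bound a f"
  using assms unfolding superexp_bound_def by blast

lemma superexp_bound_mono:
  assumes "superexp_bound a g" "\<forall>\<^sub>F n in sequentially. norm (f n) \<le> norm (g n)"
  shows "superexp_bound a f"
proof -
  from assms(1) obtain C where
    "\<forall>\<^sub>F n in sequentially. norm (g n) \<le> exp (a * (real n * ln (real n)) + C * real n)"
    unfolding superexp_bound_def by blast
  with assms(2) have "\<forall>\<^sub>F n in sequentially. norm (f n) \<le> exp (a * (real n * ln (real n)) + C * real n)"
    by eventually_elim simp
  then show ?thesis by (rule superexp_boundI)
qed

lemma superexp_bound_mult:
  fixes f g :: "nat \<Rightarrow> 'a::real_normed_algebra"
  assumes "superexp_bound a f" "superexp_bound b g"
  shows "superexp_bound (a + b) (\<lambda>n. f n * g n)"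
proof -
  from assms obtain C D where
    "\<forall>\<^sub>F n in sequentially. norm (f n) \<le> exp (a * (real n * ln (real n)) + C * real n)"
    "\<forall>\<^sub>F n in sequentially. norm (g n) \<le> exp (b * (real n * ln (real n)) + D * real n)"
    unfolding superexp_bound_def by blast
  then have "\<forall>\<^sub>F n in sequentially. norm (f n * g n)
      \<le> exp ((a + b) * (real n * ln (real n)) + (C + D) * real n)"
  proof eventually_elim
    case (elim n)
    have "norm (f n * g n) \<le> norm (f n) * norm (g n)"
      by (rule norm_mult_ineq)
    also have "\<dots> \<le> exp (a * (real n * ln (real n)) + C * real n) * exp (b * (real n * ln (real n)) + D * real n)"
      using elim by (intro mult_mono) auto
    finally show ?case
      by (simp add: algebra_simps flip: exp_add)
  qed
  then show ?thesis by (rule superexp_boundI)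
qed

lemma superexp_bound_const: "superexp_bound 0 (\<lambda>_. c)"
proof (rule superexp_boundI)
  show "\<forall>\<^sub>F n in sequentially. norm c \<le> exp (0 * (real n * ln (real n)) + norm c * real n)"
    using eventually_ge_at_top[of 1]
  proof eventually_elim
    case (elim n)
    have "norm c * 1 \<le> norm c * real n" using elim by (intro mult_left_mono) auto
    also have "\<dots> \<le> exp (norm c * real n)" using exp_ge_add_one_self[of "norm c * real n"] by linarith
    finally show ?case by simp
  qed
qed

lemma superexp_bound_power:
  fixes z :: "'a::real_normed_div_algebra"
  shows "superexp_bound 0 (\<lambda>n. z ^ n)"
proof (rule superexp_boundI, rule always_eventually, rule allI)
  fix n
  have "norm z \<le> exp (norm z)" using exp_ge_add_one_self[of "norm z"] by linarith
  then have "norm z ^ n \<le> exp (norm z) ^ n" by (intro power_mono) auto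
  then show "norm (z ^ n) \<le> exp (0 * (real n * ln (real n)) + norm z * real n)"
    by (simp add: norm_power exp_of_nat_mult mult.commute)
qed

lemma superexp_bound_prod:
  fixes f :: "'i \<Rightarrow> nat \<Rightarrow> 'a::{real_normed_algebra_1, comm_monoid_mult}"
  assumes "finite A" "\<And>i. i \<in> A \<Longrightarrow> superexp_bound (a i) (f i)"
  shows "superexp_bound (\<Sum>i\<in>A. a i) (\<lambda>n. \<Prod>i\<in>A. f i n)"
  using assms by (induction A rule: finite_induct) (auto intro: superexp_bound_const superexp_bound_mult)

text \<open>Absorbs the cost \<open>exp (C * \<bar>Im z\<bar>)\<close> of passing from real to
  complex arguments: along an arithmetic progression the imaginary part grows at most
  linearly.\<close>

lemma superexp_bound_exp_abs_affine:
  assumes "C \<ge> 0"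
  shows "superexp_bound 0 (\<lambda>n. exp (C * \<bar>A * real n + B\<bar>) :: real)"
proof (rule superexp_boundI[where C = "C * (\<bar>A\<bar> + \<bar>B\<bar>)"])
  show "\<forall>\<^sub>F n in sequentially. norm (exp (C * \<bar>A * real n + B\<bar>))
      \<le> exp (0 * (real n * ln (real n)) + C * (\<bar>A\<bar> + \<bar>B\<bar>) * real n)"
    using eventually_ge_at_top[of 1]
  proof eventually_elim
    case (elim n)
    have "\<bar>A * real n + B\<bar> \<le> \<bar>A * real n\<bar> + \<bar>B\<bar>" by simp
    also have "\<dots> \<le> \<bar>A\<bar> * real n + \<bar>B\<bar> * real n"
      using elim mult_left_mono[of 1 "real n" "\<bar>B\<bar>"] by (simp add: abs_mult)
    finally show ?case using assms
      by (simp add: mult_left_mono mult.assoc flip: distrib_right)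
  qed
qed

text \<open>A negative order wins against every \<open>exp (C * n)\<close>, so the terms are
  eventually dominated by the geometric series of \<open>exp (-1)\<close>.\<close>

lemma superexp_bound_summable:
  fixes f :: "nat \<Rightarrow> 'a::real_normed_vector"
  assumes "superexp_bound a f" "a < 0"
  shows "summable (\<lambda>n. norm (f n))"
proof -
  from assms(1) obtain C where
    C: "\<forall>\<^sub>F n in sequentially. norm (f n) \<le> exp (a * (real n * ln (real n)) + C * real n)"
    unfolding superexp_bound_def by blast
  have "filterlim (\<lambda>n::nat. ln (real n)) at_top sequentially" by real_asymp
  \<comment> \<open>The threshold is the solution of \<open>a * l + C = -1\<close> for
    \<open>l = ln n\<close>.\<close>
  then have "\<forall>\<^sub>F n in sequentially. ln (real n) \<ge> (C + 1) / (-a)"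
    by (simp add: filterlim_at_top)
  with C have "\<forall>\<^sub>F n in sequentially. norm (norm (f n)) \<le> exp (-1) ^ n"
  proof eventually_elim
    case (elim n)
    have "a * ln (real n) + C \<le> -1"
      using elim(2) assms(2) by (simp add: field_simps)
    then have "real n * (a * ln (real n) + C) \<le> real n * (-1)" by (intro mult_left_mono) auto
    then have "a * (real n * ln (real n)) + C * real n \<le> real n * (-1)"
      by (simp add: algebra_simps)
    then have "exp (a * (real n * ln (real n)) + C * real n) \<le> exp (real n * (-1))"
      by (simp only: exp_le_cancel_iff)
    also have "\<dots> = exp (-1) ^ n" by (rule exp_of_nat_mult)
    finally show ?case using elim(1) by simp
  qed
  then show ?thesis
    by (rule summable_comparison_test_ev) (simp add: summable_geometric)
qed

section \<open>Growth of the real Gamma function\<close>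

text \<open>Gamma increases on \<open>[2, \<infinity>)\<close>, so rounding \<open>y\<close> up to
  an integer \<open>k + 1\<close> bounds it by \<open>k!\<close>, which is at most
  \<open>k ^ k\<close>.\<close>

lemma Gamma_le_exp:
  fixes y :: real
  assumes "y \<ge> 2"
  shows "Gamma y \<le> exp (y * ln y)"
proof -
  define k where "k = nat \<lceil>y\<rceil> - 1"
  have k: "real k + 1 \<ge> y" "real k \<le> y" "k \<ge> 1" using assms unfolding k_def by linarith+
  have "Gamma y \<le> Gamma (1 + real k)"
    using Gamma_real_strict_mono[of y "1 + real k"] k assms by (cases "y = 1 + real k") auto
  also have "\<dots> = fact k" by (rule Gamma_fact)
  also have "\<dots> \<le> real k ^ k" by (metis fact_le_power of_nat_fact of_nat_le_iff of_nat_power order_refl)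
  also have "\<dots> = exp (real k * ln (real k))" using k by (simp add: exp_of_nat_mult)
  also have "\<dots> \<le> exp (y * ln y)" using k assms by (simp add: mult_mono)
  finally show ?thesis .
qed

text \<open>Rounding \<open>y\<close> down to an integer \<open>k + 1\<close> bounds Gamma below by
  \<open>k!\<close>, which is at least \<open>k ^ k / exp k\<close>. Here \<open>k\<close> lies
  between \<open>y - 2\<close> and \<open>y - 1\<close>, whence the shift by 2.\<close>

lemma exp_le_Gamma:
  fixes y :: real
  assumes "y \<ge> 3"
  shows "exp ((y - 2) * ln (y - 2) - y) \<le> Gamma y"
proof -
  define k where "k = nat \<lfloor>y\<rfloor> - 1"
  have k: "real k + 1 \<le> y" "real k \<ge> y - 2" "k \<ge> 2" using assms unfolding k_def by linarith+
  have "(y - 2) * ln (y - 2) \<le> real k * ln (real k)" using k assms by (intro mult_mono) auto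
  then have "exp ((y - 2) * ln (y - 2) - y) \<le> exp (real k * ln (real k) - real k)"
    using k by simp
  also have "\<dots> = real k ^ k / exp (real k)" using k by (simp add: exp_diff exp_of_nat_mult)
  also have "\<dots> \<le> fact k"
  proof -
    \<comment> \<open>One term of the exponential series at \<open>k\<close> is at most the whole
      sum.\<close>
    have "real k ^ k /\<^sub>R fact k \<le> exp (real k)"
      using sum_le_suminf[OF summable_exp_generic[of "real k"], of "{k}"] by (simp add: exp_def)
    then show ?thesis by (simp add: field_simps)
  qed
  also have "fact k = Gamma (1 + real k)" by (rule Gamma_fact [symmetric])
  also have "\<dots> \<le> Gamma y"
    using Gamma_real_strict_mono[of "1 + real k" y] k assms by (cases "y = 1 + real k") auto
  finally show ?thesis .
qed

text \<open>As \<open>ln (p * n + q) = ln n + ln p + O(1/n)\<close>, the difference is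
  \<open>p * ln p * n + q * ln n + O(1)\<close>. Thus an offset \<open>q\<close> never changes the
  order, and the slope \<open>p\<close> enters only as the coefficient of
  \<open>n * ln n\<close>.\<close>

lemma affine_mult_ln_bigo:
  fixes p q :: real
  assumes "p > 0"
  shows "(\<lambda>n::nat. (p * real n + q) * ln (p * real n + q) - p * (real n * ln (real n))) \<in> O(\<lambda>n. real n)"
  using assms by real_asymp

lemma superexp_bound_Gamma_real:
  fixes p q :: real
  assumes "p > 0"
  shows "superexp_bound p (\<lambda>n. Gamma (p * real n + q))"
proof -
  obtain C where C: "\<forall>\<^sub>F n in sequentially.
      norm ((p * real n + q) * ln (p * real n + q) - p * (real n * ln (real n))) \<le> C * norm (real n)"
    using affine_mult_ln_bigo[OF assms, of q] by (elim landau_o.bigE)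
  have "\<forall>\<^sub>F n in sequentially. p * real n + q \<ge> 2" using assms by real_asymp
  with C have "\<forall>\<^sub>F n in sequentially. norm (Gamma (p * real n + q)) \<le> exp (p * (real n * ln (real n)) + C * real n)"
  proof eventually_elim
    case (elim n)
    have "norm (Gamma (p * real n + q)) = Gamma (p * real n + q)"
      using elim Gamma_real_pos[of "p * real n + q"] by simp
    also have "\<dots> \<le> exp ((p * real n + q) * ln (p * real n + q))" using elim by (intro Gamma_le_exp)
    also have "\<dots> \<le> exp (p * (real n * ln (real n)) + C * real n)" using elim by (auto simp: abs_le_iff)
    finally show ?case .
  qed
  then show ?thesis by (rule superexp_boundI)
qed

lemma superexp_bound_rGamma_real:
  fixes p q :: real
  assumes "p > 0"
  shows "superexp_bound (- p) (\<lambda>n. rGamma (p * real n + q))"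
proof -
  \<comment> \<open>The offset is \<open>q - 2\<close> because \<open>exp_le_Gamma\<close> is stated
    with \<open>y - 2\<close>.\<close>
  obtain C where C: "\<forall>\<^sub>F n in sequentially.
      norm ((p * real n + (q - 2)) * ln (p * real n + (q - 2)) - p * (real n * ln (real n))) \<le> C * norm (real n)"
    using affine_mult_ln_bigo[OF assms, of "q - 2"] by (elim landau_o.bigE)
  have "\<forall>\<^sub>F n in sequentially. p * real n + q \<ge> 3" using assms by real_asymp
  with C eventually_ge_at_top[of 1]
  have "\<forall>\<^sub>F n in sequentially. norm (rGamma (p * real n + q))
      \<le> exp (- p * (real n * ln (real n)) + (C + p + \<bar>q\<bar>) * real n)"
  proof eventually_elim
    case (elim n)
    let ?y = "p * real n + q"
    \<comment> \<open>The remaining linear term \<open>y\<close> in the exponent of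
      \<open>exp_le_Gamma\<close> accounts for the extra constant
      \<open>p + \<bar>q\<bar>\<close>.\<close>
    have "\<bar>q\<bar> \<le> \<bar>q\<bar> * real n" using elim mult_left_mono[of 1 "real n" "\<bar>q\<bar>"] by simp
    then have y: "?y \<le> (p + \<bar>q\<bar>) * real n" using elim by (simp add: algebra_simps)
    have "norm (rGamma ?y) = inverse (Gamma ?y)"
      using elim Gamma_real_pos[of ?y] by (simp add: rGamma_inverse_Gamma)
    also have "\<dots> \<le> inverse (exp ((?y - 2) * ln (?y - 2) - ?y))"
      using elim by (intro le_imp_inverse_le exp_le_Gamma) auto
    also have "\<dots> = exp (?y - (?y - 2) * ln (?y - 2))" by (simp flip: exp_minus)
    also have "\<dots> \<le> exp (- p * (real n * ln (real n)) + (C + p + \<bar>q\<bar>) * real n)"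
    proof -
      have "p * (real n * ln (real n)) - (?y - 2) * ln (?y - 2) \<le> C * real n"
        using elim by (auto simp: abs_le_iff algebra_simps)
      with y show ?thesis by (simp add: algebra_simps)
    qed
    finally show ?case .
  qed
  then show ?thesis by (rule superexp_boundI)
qed

section \<open>Complex Gamma values compared with real ones\<close>

text \<open>The total function \<open>Gamma\<close> vanishes only at its poles, by convention, and
  these are the nonpositive integers.\<close>

lemma Gamma_neq_0_of_Re_pos:
  fixes z :: complex
  assumes "Re z > 0"
  shows "Gamma z \<noteq> 0"
proof
  assume "Gamma z = 0"
  then obtain n where n: "z = of_int n" "n \<le> 0"
    by (auto simp: Gamma_eq_zero_iff elim!: nonpos_Ints_cases)
  from arg_cong[OF n(1), of Re] n(2) assms show False by simp
qed

lemma norm_pochhammer_ge: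
  fixes z :: complex
  assumes "Re z > 0"
  shows "pochhammer (Re z) n \<le> norm (pochhammer z n)"
  unfolding pochhammer_prod prod_norm[symmetric]
proof (intro prod_mono conjI)
  fix i
  show "0 \<le> Re z + of_nat i" using assms by simp
  show "Re z + of_nat i \<le> norm (z + of_nat i)"
    using complex_Re_le_cmod[of "z + of_nat i"] by simp
qed

text \<open>The normalising power of \<open>n\<close> in the Euler product has a modulus depending
  only on \<open>Re z\<close>, so comparing products reduces to comparing the
  \<open>pochhammer\<close> factors.\<close>

lemma norm_rGamma_series:
  fixes z :: complex
  assumes "n > 0"
  shows "norm (rGamma_series z n) = norm (pochhammer z (n + 1)) / (fact n * exp (Re z * ln (real n)))"
  using assms by (simp add: rGamma_series_def norm_divide norm_mult)

text \<open>In the Euler product, dropping the imaginary part shrinks each factor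
  \<open>z + i\<close> and leaves the modulus of the normalisation unchanged; the inequality
  survives the limit.\<close>

lemma rGamma_Re_le_norm:
  fixes z :: complex
  assumes "Re z > 0"
  shows "rGamma (Re z) \<le> norm (rGamma z)"
proof (rule tendsto_le[OF _ tendsto_norm[OF rGamma_series_LIMSEQ] rGamma_series_LIMSEQ])
  show "\<forall>\<^sub>F n in sequentially. rGamma_series (Re z) n \<le> norm (rGamma_series z n)"
    using eventually_gt_at_top[of 0]
  proof eventually_elim
    case (elim n)
    then show ?case using norm_pochhammer_ge[OF assms, of "n + 1"]
      by (simp only: norm_rGamma_series) (simp add: rGamma_series_def divide_right_mono)
  qed
qed auto

lemma norm_Gamma_le_Gamma_Re:
  fixes z :: complex
  assumes "Re z > 0"
  shows "norm (Gamma z) \<le> Gamma (Re z)"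
proof -
  have "inverse (norm (rGamma z)) \<le> inverse (rGamma (Re z))"
    using assms Gamma_real_pos[OF assms]
    by (intro le_imp_inverse_le rGamma_Re_le_norm) (auto simp: rGamma_inverse_Gamma)
  then show ?thesis by (simp add: rGamma_inverse_Gamma norm_inverse)
qed

text \<open>For fixed \<open>t\<close> the ratio \<open>\<bar>\<sigma> + i t\<bar> / \<sigma>\<close> decreases in \<open>\<sigma>\<close>, so the Euler products can be
  compared factor by factor with those on the line \<open>Re z = 1/2\<close>, where the reflection formula
  gives the modulus.\<close>

lemma norm_pochhammer_compare:
  fixes z :: complex
  assumes "Re z \<ge> 1/2"
  shows "norm (pochhammer z n) * pochhammer (1/2) n
    \<le> pochhammer (Re z) n * norm (pochhammer (Complex (1/2) (Im z)) n)"
  unfolding pochhammer_prod prod_norm[symmetric] prod.distrib[symmetric]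
proof (intro prod_mono conjI)
  fix i
  define r s t where "r = Re z + real i" "s = 1/2 + real i" "t = Im z"
  have rs: "r \<ge> s" "s > 0" using assms by (auto simp: r_s_t_def)
  have "sqrt (r\<^sup>2 + t\<^sup>2) * s = sqrt ((r\<^sup>2 + t\<^sup>2) * s\<^sup>2)" using rs by (simp add: real_sqrt_mult)
  also have "\<dots> \<le> sqrt (r\<^sup>2 * (s\<^sup>2 + t\<^sup>2))"
  proof (rule real_sqrt_le_mono)
    have "s\<^sup>2 * t\<^sup>2 \<le> r\<^sup>2 * t\<^sup>2" using rs by (intro mult_right_mono power_mono) auto
    then show "(r\<^sup>2 + t\<^sup>2) * s\<^sup>2 \<le> r\<^sup>2 * (s\<^sup>2 + t\<^sup>2)" by (simp add: algebra_simps)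
  qed
  also have "\<dots> = r * sqrt (s\<^sup>2 + t\<^sup>2)" using rs by (simp add: real_sqrt_mult)
  finally show "norm (z + of_nat i) * (1/2 + of_nat i)
      \<le> (Re z + of_nat i) * norm (Complex (1/2) (Im z) + of_nat i)"
    by (simp add: cmod_def r_s_t_def)
qed simp

lemma norm_sin_le_exp:
  fixes z :: complex
  shows "norm (sin z) \<le> exp \<bar>Im z\<bar>"
proof -
  have "norm (sin z) = norm (exp (\<i> * z) - exp (- (\<i> * z))) / 2"
    by (simp add: sin_exp_eq norm_divide norm_mult)
  also have "\<dots> \<le> (norm (exp (\<i> * z)) + norm (exp (- (\<i> * z)))) / 2"
    by (intro divide_right_mono norm_triangle_ineq4) auto
  also have "\<dots> = (exp (- Im z) + exp (Im z)) / 2" by simp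
  also have "\<dots> \<le> (exp \<bar>Im z\<bar> + exp \<bar>Im z\<bar>) / 2" by (intro divide_right_mono add_mono) auto
  finally show ?thesis by simp
qed

text \<open>On this line \<open>1 - z\<close> is the conjugate of \<open>z\<close>, so the
  reflection formula gives the squared modulus exactly as
  \<open>\<bar>sin (pi * z)\<bar> / pi\<close>, and \<open>1 / pi\<close> is the square of
  \<open>rGamma (1/2)\<close>.\<close>

lemma norm_rGamma_half_line:
  "norm (rGamma (Complex (1/2) t)) \<le> rGamma (1/2) * exp (pi / 2 * \<bar>t\<bar>)"
proof -
  let ?z = "Complex (1/2) t"
  have "1 - ?z = cnj ?z" by (simp add: complex_eq_iff)
  moreover have "rGamma (cnj ?z) = cnj (rGamma ?z)"
    by (simp add: cnj_rGamma)
  ultimately have "norm (rGamma ?z) ^ 2 = norm (rGamma ?z * rGamma (1 - ?z))"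
    by (simp add: norm_mult power2_eq_square)
  also have "\<dots> = norm (sin (of_real pi * ?z)) / pi"
    by (simp add: rGamma_reflection_complex norm_divide)
  also have "\<dots> \<le> exp (pi * \<bar>t\<bar>) / pi"
    using norm_sin_le_exp[of "of_real pi * ?z"] by (simp add: divide_right_mono abs_mult)
  also have "\<dots> = (rGamma (1/2) * exp (pi / 2 * \<bar>t\<bar>)) ^ 2"
    using exp_double[of "pi / 2 * \<bar>t\<bar>"]
    by (simp add: rGamma_inverse_Gamma Gamma_one_half_real power_mult_distrib power_inverse field_simps)
  finally show ?thesis
    by (rule power2_le_imp_le) (simp add: rGamma_inverse_Gamma Gamma_one_half_real)
qed

lemma norm_rGamma_le:
  fixes z :: complex
  assumes "Re z \<ge> 1/2"
  shows "norm (rGamma z) \<le> rGamma (Re z) * exp (pi / 2 * \<bar>Im z\<bar>)"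
proof -
  let ?w = "Complex (1/2) (Im z)"
  have "norm (rGamma z) * rGamma (1/2) \<le> rGamma (Re z) * norm (rGamma ?w)"
  proof (rule tendsto_le[OF _ tendsto_mult[OF rGamma_series_LIMSEQ tendsto_norm[OF rGamma_series_LIMSEQ]]
        tendsto_mult[OF tendsto_norm[OF rGamma_series_LIMSEQ] rGamma_series_LIMSEQ]])
    show "\<forall>\<^sub>F n in sequentially. norm (rGamma_series z n) * rGamma_series (1/2) n
        \<le> rGamma_series (Re z) n * norm (rGamma_series ?w n)"
      using eventually_gt_at_top[of 0]
    proof eventually_elim
      case (elim n)
      \<comment> \<open>On both sides the normalisation is \<open>(fact n)^2\<close> times
        \<open>n\<close> to the power \<open>Re z + 1/2\<close>, so it cancels and the comparison of
        the finite products is what remains.\<close>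
      then show ?case using norm_pochhammer_compare[OF assms, of "n + 1"]
        by (simp only: norm_rGamma_series) (simp add: rGamma_series_def divide_simps mult_ac)
    qed
  qed auto
  also have "\<dots> \<le> rGamma (Re z) * (rGamma (1/2) * exp (pi / 2 * \<bar>Im z\<bar>))"
    using assms Gamma_real_pos[of "Re z"]
    by (intro mult_left_mono norm_rGamma_half_line) (auto simp: rGamma_inverse_Gamma)
  finally show ?thesis
    by (simp add: rGamma_inverse_Gamma Gamma_one_half_real field_simps)
qed

text \<open>Reflection moves \<open>z\<close> to \<open>1 - z\<close> in the right half-plane, where
  Gamma is bounded by its value at the real part; the sine contributes the exponential
  factor.\<close>

lemma norm_rGamma_le_reflect:
  fixes z :: complex
  assumes "Re z < 1"
  shows "norm (rGamma z) \<le> Gamma (1 - Re z) * exp (pi * \<bar>Im z\<bar>)"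
proof -
  have "rGamma (1 - z) \<noteq> 0"
    using Gamma_neq_0_of_Re_pos[of "1 - z"] assms by (simp add: Gamma_def)
  then have "rGamma z = Gamma (1 - z) * (sin (of_real pi * z) / of_real pi)"
    using rGamma_reflection_complex[of z] by (simp add: Gamma_def field_simps)
  then have "norm (rGamma z) = norm (Gamma (1 - z)) * (norm (sin (of_real pi * z)) / pi)"
    by (simp add: norm_mult norm_divide)
  also have "\<dots> \<le> Gamma (1 - Re z) * exp (pi * \<bar>Im z\<bar>)"
  proof (intro mult_mono)
    show "norm (Gamma (1 - z)) \<le> Gamma (1 - Re z)"
      using norm_Gamma_le_Gamma_Re[of "1 - z"] assms by simp
    have "norm (sin (of_real pi * z)) / pi \<le> norm (sin (of_real pi * z)) / 1"
      using pi_ge_two by (intro divide_left_mono) auto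
    also have "\<dots> \<le> exp (pi * \<bar>Im z\<bar>)" using norm_sin_le_exp[of "of_real pi * z"] by (simp add: abs_mult)
    finally show "norm (sin (of_real pi * z)) / pi \<le> exp (pi * \<bar>Im z\<bar>)" .
  qed (use assms Gamma_real_pos[of "1 - Re z"] in auto)
  finally show ?thesis .
qed

section \<open>Growth along complex progressions\<close>

lemma superexp_bound_Gamma:
  fixes a :: complex
  assumes "p > 0"
  shows "superexp_bound p (\<lambda>n. Gamma (a + of_real p * of_nat n))"
proof (rule superexp_bound_mono[OF superexp_bound_Gamma_real[OF assms, of "Re a"]])
  have "\<forall>\<^sub>F n in sequentially. p * real n + Re a > 0" using assms by real_asymp
  then show "\<forall>\<^sub>F n in sequentially. norm (Gamma (a + of_real p * of_nat n))
      \<le> norm (Gamma (p * real n + Re a))"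
  proof eventually_elim
    case (elim n)
    then show ?case using norm_Gamma_le_Gamma_Re[of "a + of_real p * of_nat n"]
      by (simp add: add.commute)
  qed
qed

text \<open>For \<open>Re a > 0\<close> the arguments end up to the right of the line
  \<open>Re z = 1/2\<close> and the real reciprocal gives order \<open>- Re a\<close>. For
  \<open>Re a < 0\<close> they end up to its left, and reflection produces a real Gamma of slope
  \<open>- Re a\<close>, again of order \<open>- Re a\<close>.\<close>

lemma superexp_bound_rGamma:
  fixes a z :: complex
  shows "superexp_bound (- Re a) (\<lambda>n. rGamma (a * of_nat n + z))"
proof -
  let ?E = "\<lambda>C n. exp (C * \<bar>Im a * real n + Im z\<bar>)"
  have right: "superexp_bound r (\<lambda>n. rGamma (a * of_nat n + z))"
    if "\<forall>\<^sub>F n in sequentially. Re a * real n + Re z \<ge> 1/2"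
       "superexp_bound r (\<lambda>n. rGamma (Re a * real n + Re z))" for r
  proof (rule superexp_bound_mono)
    show "superexp_bound r (\<lambda>n. rGamma (Re a * real n + Re z) * ?E (pi / 2) n)"
      using superexp_bound_mult[OF that(2) superexp_bound_exp_abs_affine[of "pi / 2" "Im a" "Im z"]]
      by simp
    show "\<forall>\<^sub>F n in sequentially. norm (rGamma (a * of_nat n + z))
        \<le> norm (rGamma (Re a * real n + Re z) * ?E (pi / 2) n)"
      using that(1)
    proof eventually_elim
      case (elim n)
      have "norm (rGamma (a * of_nat n + z)) \<le> rGamma (Re a * real n + Re z) * ?E (pi / 2) n"
        using norm_rGamma_le[of "a * of_nat n + z"] elim by simp
      also have "\<dots> \<le> norm (rGamma (Re a * real n + Re z) * ?E (pi / 2) n)" by simp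
      finally show ?case .
    qed
  qed
  have left: "superexp_bound r (\<lambda>n. rGamma (a * of_nat n + z))"
    if "\<forall>\<^sub>F n in sequentially. Re a * real n + Re z < 1"
       "superexp_bound r (\<lambda>n. Gamma (- Re a * real n + (1 - Re z)))" for r
  proof (rule superexp_bound_mono)
    show "superexp_bound r (\<lambda>n. Gamma (- Re a * real n + (1 - Re z)) * ?E pi n)"
      using superexp_bound_mult[OF that(2) superexp_bound_exp_abs_affine[of pi "Im a" "Im z"]]
      by simp
    show "\<forall>\<^sub>F n in sequentially. norm (rGamma (a * of_nat n + z))
        \<le> norm (Gamma (- Re a * real n + (1 - Re z)) * ?E pi n)"
      using that(1)
    proof eventually_elim
      case (elim n)
      have "norm (rGamma (a * of_nat n + z)) \<le> Gamma (- Re a * real n + (1 - Re z)) * ?E pi n"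
        using norm_rGamma_le_reflect[of "a * of_nat n + z"] elim by (simp add: algebra_simps)
      also have "\<dots> \<le> norm (Gamma (- Re a * real n + (1 - Re z)) * ?E pi n)" by simp
      finally show ?case .
    qed
  qed
  \<comment> \<open>For \<open>Re a = 0\<close> the real part is constantly \<open>Re z\<close>, so
    the real comparison sequence is constant and has order 0; the half-planes of the two estimates
    overlap and cover every \<open>Re z\<close>.\<close>
  consider "Re a > 0" | "Re a < 0" | "Re a = 0" "Re z \<ge> 1/2" | "Re a = 0" "Re z < 1" by linarith
  then show ?thesis
  proof cases
    case 1
    then show ?thesis by (intro right superexp_bound_rGamma_real) real_asymp
  next
    case 2
    then show ?thesis by (intro left superexp_bound_Gamma_real) (real_asymp, simp)
  next
    case 3
    then show ?thesis using right[of 0] by (simp add: superexp_bound_const)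
  next
    case 4
    then show ?thesis using left[of 0] by (simp add: superexp_bound_const)
  qed
qed

section \<open>The Beta integral with complex exponents\<close>

lemma norm_of_real_powr:
  fixes t :: real and a :: complex
  assumes "t \<ge> 0"
  shows "norm (of_real t powr a) = t powr Re a"
  using assms by (simp add: norm_powr_real_powr)

lemma of_real_mult_powr:
  fixes s t :: real and a :: complex
  assumes "s \<ge> 0" "t \<ge> 0"
  shows "(of_real (s * t) :: complex) powr a = of_real s powr a * of_real t powr a"
  using assms powr_times_real[of "of_real s" "of_real t" a] by simp

text \<open>The integrand of the Beta integral stretched to the interval from 0 to \<open>x\<close>;
  with \<open>a = \<delta>\<close> and \<open>b = \<mu>\<close> it is the Riemann-Liouville
  integrand of the power \<open>\<delta> - 1\<close>.\<close>

definition beta_kernel :: "complex \<Rightarrow> complex \<Rightarrow> real \<Rightarrow> real \<Rightarrow> complex" where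
  "beta_kernel a b x t = of_real t powr (a - 1) * of_real (x - t) powr (b - 1)"

lemma beta_kernel_measurable:
  "(\<lambda>t. indicator {0<..<x} t *\<^sub>R beta_kernel a b x t) \<in> borel_measurable borel"
proof -
  have "continuous_on {0<..<x} (beta_kernel a b x)"
    unfolding beta_kernel_def [abs_def] by (auto intro!: continuous_intros)
  then show ?thesis
    by (intro borel_measurable_continuous_on_indicator) auto
qed

lemma beta_kernel_scale:
  assumes "x > 0"
  shows "indicator {0<..<x} (x * t) *\<^sub>R beta_kernel a b x (x * t)
    = of_real x powr (a + b - 2) * (indicator {0<..<1} t *\<^sub>R beta_kernel a b 1 t)"
proof (cases "t \<in> {0<..<1}")
  case True
  have "beta_kernel a b x (x * t) = of_real (x * t) powr (a - 1) * of_real (x * (1 - t)) powr (b - 1)"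
    unfolding beta_kernel_def by (simp only: right_diff_distrib mult_1_right)
  also have "\<dots> = (of_real x powr (a - 1) * of_real x powr (b - 1)) * beta_kernel a b 1 t"
    using True assms of_real_mult_powr[of x t "a - 1"] of_real_mult_powr[of x "1 - t" "b - 1"]
    by (simp add: beta_kernel_def)
  also have "(of_real x :: complex) powr (a - 1) * of_real x powr (b - 1) = of_real x powr (a - 1 + (b - 1))"
    by (rule powr_add [symmetric])
  also have "a - 1 + (b - 1) = a + b - 2" by simp
  finally show ?thesis using True assms by simp
next
  case False
  then have "x * t \<notin> {0<..<x}" using assms by (auto simp: zero_less_mult_iff)
  with False show ?thesis by (simp del: greaterThanLessThan_iff)
qed

text \<open>On the unit interval the modulus is the real Beta integrand with exponents
  \<open>Re a\<close> and \<open>Re b\<close>; homogeneity carries integrability over to general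
  \<open>x\<close>.\<close>

lemma set_integrable_beta_kernel:
  assumes "Re a > 0" "Re b > 0" "x > 0"
  shows "set_integrable lborel {0<..<x} (beta_kernel a b x)"
proof -
  have "integrable lborel (\<lambda>t. indicator {0<..<1} t *\<^sub>R beta_kernel a b 1 t)"
  proof (rule Bochner_Integration.integrable_bound)
    show "integrable lborel (\<lambda>t. indicator {0..1} t *\<^sub>R (t powr (Re a - 1) * (1 - t) powr (Re b - 1)))"
      using integrable_Beta[of "Re a" "Re b"] assms by (simp add: set_integrable_def)
    show "(\<lambda>t. indicator {0<..<1} t *\<^sub>R beta_kernel a b 1 t) \<in> borel_measurable lborel"
      using beta_kernel_measurable[of 1 a b] by simp
    show "AE t in lborel. norm (indicator {0<..<1} t *\<^sub>R beta_kernel a b 1 t)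
        \<le> norm (indicator {0..1} t *\<^sub>R (t powr (Re a - 1) * (1 - t) powr (Re b - 1)))"
      by (intro AE_I2)
        (auto simp: indicator_def beta_kernel_def norm_mult norm_of_real_powr simp del: of_real_diff)
  qed
  then have "integrable lborel (\<lambda>t. indicator {0<..<x} (0 + x * t) *\<^sub>R beta_kernel a b x (0 + x * t))"
    unfolding add_0_left beta_kernel_scale[OF assms(3)] by (rule integrable_mult_right)
  then show ?thesis
    using assms(3) unfolding set_integrable_def
    by (subst (asm) lborel_integrable_real_affine_iff) auto
qed

text \<open>The Jacobian \<open>x\<close> of the substitution raises the degree of homogeneity
  \<open>a + b - 2\<close> by one.\<close>

lemma LINT_beta_kernel_scale:
  assumes "x > 0"
  shows "(LINT t:{0<..<x}|lborel. beta_kernel a b x t)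
    = of_real x powr (a + b - 1) * (LINT t:{0<..<1}|lborel. beta_kernel a b 1 t)"
proof -
  have "(LINT t:{0<..<x}|lborel. beta_kernel a b x t)
    = \<bar>x\<bar> *\<^sub>R (\<integral>t. indicator {0<..<x} (0 + x * t) *\<^sub>R beta_kernel a b x (0 + x * t) \<partial>lborel)"
    unfolding set_lebesgue_integral_def by (rule lborel_integral_real_affine) (use assms in auto)
  also have "\<dots> = of_real x * (of_real x powr (a + b - 2) * (LINT t:{0<..<1}|lborel. beta_kernel a b 1 t))"
    unfolding add_0_left beta_kernel_scale[OF assms] set_lebesgue_integral_def
    using assms by (simp add: scaleR_conv_of_real)
  moreover have "of_real x powr (a + b - 1) = (of_real x :: complex) powr 1 * of_real x powr (a + b - 2)"
    using powr_add[of "of_real x :: complex" 1 "a + b - 2"] by (simp add: add_diff_eq)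
  ultimately show ?thesis using assms by simp
qed

section \<open>Evaluation of the Beta integral by convolution\<close>

text \<open>The integrand of Euler's integral for Gamma. The indicator belongs to the function, so
  that a convolution over the whole line is automatically restricted to
  \<open>0 < t < u\<close>.\<close>

definition gamma_kernel :: "complex \<Rightarrow> real \<Rightarrow> complex" where
  "gamma_kernel a t = indicator {0<..} t *\<^sub>R (of_real t powr (a - 1) / of_real (exp t))"

lemma gamma_kernel_measurable [measurable]: "gamma_kernel a \<in> borel_measurable borel"
proof -
  have "continuous_on {0<..} (\<lambda>t::real. of_real t powr (a - 1) / of_real (exp t))"
    by (auto intro!: continuous_intros)
  then show ?thesis
    unfolding gamma_kernel_def [abs_def] by (intro borel_measurable_continuous_on_indicator) auto
qed

lemma has_bochner_integral_gamma_kernel: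
  assumes "Re a > 0"
  shows "has_bochner_integral lborel (gamma_kernel a) (Gamma a)"
proof -
  \<comment> \<open>Absolute integrability refers to the completed Lebesgue measure; Borel
    measurability of the kernel brings it down to \<open>lborel\<close>.\<close>
  have *: "integrable lborel (gamma_kernel a)"
    using absolutely_integrable_Gamma_integral'[OF assms] gamma_kernel_measurable[of a]
    by (simp add: set_integrable_def integrable_completion gamma_kernel_def [abs_def])
  then have "integral\<^sup>L lborel (gamma_kernel a) = Gamma a"
    using set_borel_integral_eq_integral(2)[of "{0<..}" "\<lambda>t. of_real t powr (a - 1) / of_real (exp t)"]
      integral_unique[OF Gamma_integral_complex'[OF assms]]
    by (simp add: set_integrable_def set_lebesgue_integral_def gamma_kernel_def [abs_def])
  with * show ?thesis by (simp add: has_bochner_integral_iff)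
qed

text \<open>The exponentials combine to \<open>exp (- u)\<close>, which does not depend on
  \<open>t\<close>.\<close>

lemma gamma_kernel_convolution:
  "gamma_kernel a t * gamma_kernel b (u - t)
    = indicator {0<..<u} t *\<^sub>R beta_kernel a b u t / of_real (exp u)"
proof (cases "t \<in> {0<..<u}")
  case True
  then show ?thesis
    by (simp add: gamma_kernel_def beta_kernel_def exp_diff)
qed (auto simp: gamma_kernel_def)

text \<open>The convolution of two Gamma kernels is integrated in both orders. Translation
  invariance gives \<open>Gamma a * Gamma b\<close>; scaling turns the convolution into
  \<open>gamma_kernel (a + b)\<close> times the unit Beta integral, whose integral is
  \<open>Gamma (a + b)\<close> times that constant.\<close>

lemma LINT_beta_kernel_unit:
  assumes "Re a > 0" "Re b > 0"
  shows "(LINT t:{0<..<1}|lborel. beta_kernel a b 1 t) = Beta a b"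
proof -
  let ?B = "LINT t:{0<..<1}|lborel. beta_kernel a b 1 t"
  have int: "integrable lborel (gamma_kernel c)" and val: "integral\<^sup>L lborel (gamma_kernel c) = Gamma c"
    if "Re c > 0" for c
    using has_bochner_integral_gamma_kernel[OF that] by (auto simp: has_bochner_integral_iff)
  have shift_int: "integrable lborel (\<lambda>u. gamma_kernel b (u - t))" for t
    using lborel_integrable_real_affine[OF int[OF assms(2)], of 1 "- t"] by simp
  have shift: "(\<integral>u. gamma_kernel b (u - t) \<partial>lborel) = Gamma b"
     "(\<integral>u. norm (gamma_kernel b (u - t)) \<partial>lborel) = (\<integral>u. norm (gamma_kernel b u) \<partial>lborel)" for t
    using lborel_integral_real_affine[of 1 "gamma_kernel b" "- t"] val[OF assms(2)]
      lborel_integral_real_affine[of 1 "\<lambda>u. norm (gamma_kernel b u)" "- t"] by simp_all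
  \<comment> \<open>By translation invariance the inner integral of norms is
    \<open>norm (gamma_kernel a t)\<close> times a constant, hence integrable in
    \<open>t\<close>.\<close>
  have fubini: "integrable (lborel \<Otimes>\<^sub>M lborel) (\<lambda>(t, u). gamma_kernel a t * gamma_kernel b (u - t))"
  proof (rule lborel_pair.Fubini_integrable)
    show "integrable lborel (\<lambda>t. \<integral>u. norm (case (t, u) of (t, u) \<Rightarrow> gamma_kernel a t * gamma_kernel b (u - t)) \<partial>lborel)"
      using int[OF assms(1)] by (simp add: norm_mult shift)
    show "AE t in lborel. integrable lborel (\<lambda>u. case (t, u) of (t, u) \<Rightarrow> gamma_kernel a t * gamma_kernel b (u - t))"
      using shift_int by simp
  qed measurable
  have inner: "(\<integral>t. gamma_kernel a t * gamma_kernel b (u - t) \<partial>lborel) = gamma_kernel (a + b) u * ?B" for u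
  proof -
    have "(\<integral>t. gamma_kernel a t * gamma_kernel b (u - t) \<partial>lborel)
        = (LINT t:{0<..<u}|lborel. beta_kernel a b u t) / of_real (exp u)"
      by (simp add: gamma_kernel_convolution set_lebesgue_integral_def)
    moreover have "\<dots> = gamma_kernel (a + b) u * ?B"
    proof (cases "u > 0")
      case True
      then show ?thesis by (simp add: LINT_beta_kernel_scale[OF True] gamma_kernel_def)
    next
      case False
      then show ?thesis by (simp add: gamma_kernel_def set_lebesgue_integral_def)
    qed
    ultimately show ?thesis by (rule trans)
  qed
  have "Gamma a * Gamma b = (\<integral>t. (\<integral>u. gamma_kernel a t * gamma_kernel b (u - t) \<partial>lborel) \<partial>lborel)"
    using val[OF assms(1)] by (simp add: shift)
  also have "\<dots> = (\<integral>u. (\<integral>t. gamma_kernel a t * gamma_kernel b (u - t) \<partial>lborel) \<partial>lborel)"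
    using lborel_pair.Fubini_integral[OF fubini] by simp
  also have "\<dots> = Gamma (a + b) * ?B"
    using val[of "a + b"] assms by (simp add: inner)
  finally have *: "Gamma a * Gamma b = Gamma (a + b) * ?B" .
  have "Gamma (a + b) \<noteq> 0"
    using assms by (intro Gamma_neq_0_of_Re_pos) simp
  with * show ?thesis by (simp add: Beta_def field_simps)
qed

lemma LINT_beta_kernel:
  assumes "Re a > 0" "Re b > 0" "x > 0"
  shows "(LINT t:{0<..<x}|lborel. beta_kernel a b x t) = of_real x powr (a + b - 1) * Beta a b"
  unfolding LINT_beta_kernel_scale[OF assms(3)] LINT_beta_kernel_unit[OF assms(1,2)] ..

section \<open>Termwise fractional integration\<close>

lemma multiindex_bessel_term_eq:
  "multiindex_bessel_term m \<alpha> \<beta> \<gamma> \<kappa> b c z n = multiindex_bessel_term m \<alpha> \<beta> \<gamma> \<kappa> b c 1 n * z ^ n"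
  by (simp add: multiindex_bessel_term_def)

text \<open>The orders add up: \<open>\<kappa>\<close> from the Gamma factor,
  \<open>- Re (\<alpha> j)\<close> from each reciprocal, \<open>-1\<close> from the factorial, and 0
  from powers and constants.\<close>

lemma superexp_bound_multiindex_bessel_term:
  assumes "\<kappa> > 0"
  shows "superexp_bound (\<kappa> - 1 - (\<Sum>j=1..m. Re (\<alpha> j))) (multiindex_bessel_term m \<alpha> \<beta> \<gamma> \<kappa> b c z)"
proof -
  have prod: "superexp_bound (\<Sum>j=1..m. - Re (\<alpha> j))
      (\<lambda>n. \<Prod>j=1..m. rGamma (\<alpha> j * of_nat n + (\<beta> j + (b + 1) / 2)))"
    by (intro superexp_bound_prod superexp_bound_rGamma) auto
  \<comment> \<open>The factor \<open>1 / n!\<close> is the reciprocal Gamma function at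
    \<open>n + 1\<close>, so the same growth lemma covers it.\<close>
  have fact: "superexp_bound (-1) (\<lambda>n. rGamma (1 * of_nat n + 1 :: complex))"
    using superexp_bound_rGamma[of 1 1] by simp
  have "superexp_bound (0 + \<kappa> + 0 + (\<Sum>j=1..m. - Re (\<alpha> j)) + 0 + (-1))
     (\<lambda>n. c ^ n * Gamma (\<gamma> + of_real \<kappa> * of_nat n) * inverse (Gamma \<gamma>)
       * (\<Prod>j=1..m. rGamma (\<alpha> j * of_nat n + (\<beta> j + (b + 1) / 2))) * z ^ n * rGamma (1 * of_nat n + 1))"
    by (intro superexp_bound_mult superexp_bound_power superexp_bound_const superexp_bound_Gamma
        prod fact assms)
  also have "(\<lambda>n. c ^ n * Gamma (\<gamma> + of_real \<kappa> * of_nat n) * inverse (Gamma \<gamma>)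
       * (\<Prod>j=1..m. rGamma (\<alpha> j * of_nat n + (\<beta> j + (b + 1) / 2))) * z ^ n * rGamma (1 * of_nat n + 1))
      = multiindex_bessel_term m \<alpha> \<beta> \<gamma> \<kappa> b c z"
  proof
    fix n
    have "rGamma (1 * of_nat n + 1 :: complex) = inverse (fact n)"
      using Gamma_fact[of n, where ?'a = complex] by (simp add: rGamma_inverse_Gamma add.commute)
    then show "c ^ n * Gamma (\<gamma> + of_real \<kappa> * of_nat n) * inverse (Gamma \<gamma>)
       * (\<Prod>j=1..m. rGamma (\<alpha> j * of_nat n + (\<beta> j + (b + 1) / 2))) * z ^ n * rGamma (1 * of_nat n + 1)
       = multiindex_bessel_term m \<alpha> \<beta> \<gamma> \<kappa> b c z n"
      by (simp only: multiindex_bessel_term_def gen_pochhammer_def divide_inverse add.assoc mult.assoc)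
  qed
  finally show ?thesis by (simp add: sum_negf algebra_simps)
qed

text \<open>The two series differ termwise by the ratio
  \<open>\<Gamma>(\<delta> + n) / \<Gamma>(\<mu> + \<delta> + n)\<close>, which is the Beta value
  from integration without its factor \<open>\<Gamma>(\<mu>)\<close>. The factor
  \<open>Gamma \<gamma>\<close> undoes the normalisation in \<open>gen_pochhammer\<close>.\<close>

lemma fox_wright_term_eq:
  assumes "Gamma \<gamma> \<noteq> 0"
  shows "fox_wright_term [(\<gamma>, of_real \<kappa>), (\<delta>, 1)]
      (map (\<lambda>j. (\<beta> j + (b + 1) / 2, \<alpha> j)) [1..<m+1] @ [(\<mu> + \<delta>, 1)]) (c * z) n
    = Gamma \<gamma> * multiindex_bessel_term m \<alpha> \<beta> \<gamma> \<kappa> b c z n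
      * (Gamma (\<delta> + of_nat n) * rGamma (\<mu> + \<delta> + of_nat n))"
proof -
  let ?P = "\<Prod>j=1..m. rGamma (\<alpha> j * of_nat n + \<beta> j + (b + 1) / 2)"
  have "(\<Prod>j\<leftarrow>[1..<m+1]. rGamma (\<alpha> j * of_nat n + \<beta> j + (b + 1) / 2)) = ?P"
    by (subst prod.distinct_set_conv_list [symmetric])
      (simp_all add: atLeastLessThanSuc_atLeastAtMost del: upt_Suc)
  then have "(\<Prod>(b', B)\<leftarrow>map (\<lambda>j. (\<beta> j + (b + 1) / 2, \<alpha> j)) [1..<m+1]. rGamma (b' + B * of_nat n)) = ?P"
    by (simp add: o_def add_ac del: upt_Suc)
  then have "fox_wright_term [(\<gamma>, of_real \<kappa>), (\<delta>, 1)]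
      (map (\<lambda>j. (\<beta> j + (b + 1) / 2, \<alpha> j)) [1..<m+1] @ [(\<mu> + \<delta>, 1)]) (c * z) n
    = Gamma (\<gamma> + of_real \<kappa> * of_nat n) * Gamma (\<delta> + of_nat n)
      * (?P * rGamma (\<mu> + \<delta> + of_nat n)) * ((c * z) ^ n / fact n)"
    unfolding fox_wright_term_def map_append prod_list.append by simp
  also have "\<dots> = Gamma \<gamma> * multiindex_bessel_term m \<alpha> \<beta> \<gamma> \<kappa> b c z n
      * (Gamma (\<delta> + of_nat n) * rGamma (\<mu> + \<delta> + of_nat n))"
    using assms by (simp add: multiindex_bessel_term_def gen_pochhammer_def power_mult_distrib)
  finally show ?thesis .
qed

section \<open>Integration of the kernel against a power series\<close>

lemma beta_kernel_mult_power:
  assumes "t > 0"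
  shows "beta_kernel a b x t * of_real t ^ n = beta_kernel (a + of_nat n) b x t"
proof -
  have "a + of_nat n - 1 = a - 1 + of_nat n" by simp
  then have "(of_real t :: complex) powr (a + of_nat n - 1) = of_real t powr (a - 1 + of_nat n)"
    by (simp only:)
  also have "\<dots> = of_real t powr (a - 1) * of_real t ^ n"
    using assms by (subst powr_add) (simp add: powr_nat)
  finally show ?thesis by (simp only: beta_kernel_def mult_ac)
qed

lemma rl_integrand_eq_beta_kernel:
  "rl_integrand \<mu> (\<lambda>t. of_real t powr (\<delta> - 1) * g t) x t = beta_kernel \<delta> \<mu> x t * g t"
proof -
  \<comment> \<open>This includes \<open>t = x\<close>, where both sides are 0 because
    \<open>0 powr w\<close> and \<open>inverse 0\<close> are 0.\<close>
  have "inverse (of_real (x - t) powr (1 - \<mu>)) = (of_real (x - t) :: complex) powr (\<mu> - 1)"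
    using powr_minus[of "of_real (x - t) :: complex" "1 - \<mu>"] by simp
  then show ?thesis by (simp add: rl_integrand_def beta_kernel_def divide_inverse mult_ac)
qed

text \<open>The kernel integrals of \<open>t\<^sup>n\<close> are at most \<open>x\<^sup>n\<close> times the one of \<open>1\<close>, so absolute
  convergence of the power series at \<open>x\<close> alone justifies termwise integration.\<close>

lemma
  fixes A :: "nat \<Rightarrow> complex"
  assumes "Re \<delta> > 0" "Re \<mu> > 0" "x > 0"
    and A: "summable (\<lambda>n. norm (A n * of_real x ^ n))"
  shows set_integrable_beta_kernel_powser:
      "set_integrable lborel {0<..<x} (\<lambda>t. beta_kernel \<delta> \<mu> x t * (\<Sum>n. A n * of_real t ^ n))"
    and sums_beta_kernel_powser:
      "(\<lambda>n. A n * (of_real x powr (\<delta> + of_nat n + \<mu> - 1) * Beta (\<delta> + of_nat n) \<mu>)) sums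
        (LINT t:{0<..<x}|lborel. beta_kernel \<delta> \<mu> x t * (\<Sum>n. A n * of_real t ^ n))"
proof -
  \<comment> \<open>Absorbing \<open>t ^ n\<close> into the first exponent makes each term a Beta
    integrand; \<open>f_eq\<close> separates the two again for the estimates.\<close>
  let ?f = "\<lambda>n t. A n * (indicator {0<..<x} t *\<^sub>R beta_kernel (\<delta> + of_nat n) \<mu> x t)"
  have f_eq: "?f n t = indicator {0<..<x} t *\<^sub>R beta_kernel \<delta> \<mu> x t * (A n * of_real t ^ n)" for n t
    by (cases "t > 0") (auto simp flip: beta_kernel_mult_power)
  have le: "norm (A n * of_real t ^ n) \<le> norm (A n * of_real x ^ n)" if "t \<in> {0<..<x}" for n t
    using that by (auto simp: norm_mult norm_power intro!: mult_left_mono power_mono)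
  have summ: "summable (\<lambda>n. norm (A n * of_real t ^ n))" if "t \<in> {0<..<x}" for t
    by (rule summable_comparison_test'[OF A, of 0]) (use le[OF that] in simp)
  have int: "integrable lborel (?f n)" for n
    using set_integrable_beta_kernel[of "\<delta> + of_nat n" \<mu> x] assms
    unfolding set_integrable_def by (intro integrable_mult_right) simp
  have int0: "integrable lborel (\<lambda>t. norm (indicator {0<..<x} t *\<^sub>R beta_kernel \<delta> \<mu> x t))"
    using set_integrable_beta_kernel[of \<delta> \<mu> x] assms unfolding set_integrable_def
    by (intro integrable_norm) auto
  let ?K = "\<integral>t. norm (indicator {0<..<x} t *\<^sub>R beta_kernel \<delta> \<mu> x t) \<partial>lborel"
  have ptw: "AE t in lborel. summable (\<lambda>n. norm (?f n t))"
  proof (intro AE_I2)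
    fix t
    show "summable (\<lambda>n. norm (?f n t))"
      unfolding f_eq norm_mult[of "indicator {0<..<x} t *\<^sub>R beta_kernel \<delta> \<mu> x t"]
      by (cases "t \<in> {0<..<x}") (intro summable_mult summ, auto)
  qed
  have int_le: "(\<integral>t. norm (?f n t) \<partial>lborel) \<le> norm (A n * of_real x ^ n) * ?K" for n
  proof -
    have "(\<integral>t. norm (?f n t) \<partial>lborel) \<le>
        (\<integral>t. norm (A n * of_real x ^ n) * norm (indicator {0<..<x} t *\<^sub>R beta_kernel \<delta> \<mu> x t) \<partial>lborel)"
    proof (rule integral_mono)
      fix t
      show "norm (?f n t) \<le> norm (A n * of_real x ^ n) * norm (indicator {0<..<x} t *\<^sub>R beta_kernel \<delta> \<mu> x t)"
        unfolding f_eq norm_mult[of "indicator {0<..<x} t *\<^sub>R beta_kernel \<delta> \<mu> x t"]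
        using mult_right_mono[OF le[of t n], of "norm (beta_kernel \<delta> \<mu> x t)"]
        by (cases "t \<in> {0<..<x}") (auto simp: mult.commute)
    qed (intro integrable_norm int integrable_mult_right int0)+
    then show ?thesis by simp
  qed
  have "summable (\<lambda>n. \<integral>t. norm (?f n t) \<partial>lborel)"
    by (rule summable_comparison_test'[OF summable_mult2[OF A, of ?K], of 0])
       (use int_le in simp)
  \<comment> \<open>These are the hypotheses for exchanging sum and integral: integrable terms,
    pointwise absolute convergence, and summable integrals of norms.\<close>
  note series = int ptw this
  have sum_eq: "(\<Sum>n. ?f n t)
      = indicator {0<..<x} t *\<^sub>R (beta_kernel \<delta> \<mu> x t * (\<Sum>n. A n * of_real t ^ n))" for t
  proof (cases "t \<in> {0<..<x}")
    case True
    then show ?thesis unfolding f_eq using summable_norm_cancel[OF summ[OF True]]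
      by (simp add: suminf_mult)
  qed auto
  show "set_integrable lborel {0<..<x} (\<lambda>t. beta_kernel \<delta> \<mu> x t * (\<Sum>n. A n * of_real t ^ n))"
    using integrable_suminf[OF series] by (simp only: sum_eq set_integrable_def)
  have "(\<integral>t. ?f n t \<partial>lborel) = A n * (of_real x powr (\<delta> + of_nat n + \<mu> - 1) * Beta (\<delta> + of_nat n) \<mu>)" for n
    using LINT_beta_kernel[of "\<delta> + of_nat n" \<mu> x] assms
    unfolding set_lebesgue_integral_def by (subst integral_mult_right_zero) simp
  then show "(\<lambda>n. A n * (of_real x powr (\<delta> + of_nat n + \<mu> - 1) * Beta (\<delta> + of_nat n) \<mu>)) sums
        (LINT t:{0<..<x}|lborel. beta_kernel \<delta> \<mu> x t * (\<Sum>n. A n * of_real t ^ n))"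
    using sums_integral[OF series] by (simp only: sum_eq set_lebesgue_integral_def)
qed

theorem theorem1:
  fixes m :: nat
    and \<alpha> \<beta> :: "nat \<Rightarrow> complex"
    and \<gamma> b c \<mu> \<delta> :: complex
    and \<kappa> x :: real
  assumes "\<kappa> > 0"
    and "(\<Sum>j=1..m. Re (\<alpha> j)) > max 0 (\<kappa> - 1)"
    and "\<And>j. j \<in> {1..m} \<Longrightarrow> Re (\<beta> j) > 0"
    and "Re \<gamma> > 0"
    and "Re \<mu> > 0"
    and "Re \<delta> > 0"
    and "x > 0"
  shows "(\<forall>t\<in>{0<..<x}. summable (multiindex_bessel_term m \<alpha> \<beta> \<gamma> \<kappa> b c (of_real t))) \<and>
     rl_integrable \<mu> (\<lambda>t. of_real t powr (\<delta> - 1) * multiindex_bessel m \<alpha> \<beta> \<gamma> \<kappa> b c (of_real t)) x \<and>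
     summable (fox_wright_term [(\<gamma>, of_real \<kappa>), (\<delta>, 1)]
       (map (\<lambda>j. (\<beta> j + (b + 1) / 2, \<alpha> j)) [1..<m+1] @ [(\<mu> + \<delta>, 1)]) (c * of_real x)) \<and>
     rl_integral \<mu> (\<lambda>t. of_real t powr (\<delta> - 1) * multiindex_bessel m \<alpha> \<beta> \<gamma> \<kappa> b c (of_real t)) x =
       of_real x powr (\<mu> + \<delta> - 1) / Gamma \<gamma> *
       fox_wright [(\<gamma>, of_real \<kappa>), (\<delta>, 1)]
         (map (\<lambda>j. (\<beta> j + (b + 1) / 2, \<alpha> j)) [1..<m+1] @ [(\<mu> + \<delta>, 1)]) (c * of_real x)"
proof -
  \<comment> \<open>The value at \<open>z = 1\<close> isolates the power series
    coefficients.\<close>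
  define A where "A = multiindex_bessel_term m \<alpha> \<beta> \<gamma> \<kappa> b c 1"
  let ?fw = "fox_wright_term [(\<gamma>, of_real \<kappa>), (\<delta>, 1)]
       (map (\<lambda>j. (\<beta> j + (b + 1) / 2, \<alpha> j)) [1..<m+1] @ [(\<mu> + \<delta>, 1)]) (c * of_real x)"
  let ?I = "LINT t:{0<..<x}|lborel. beta_kernel \<delta> \<mu> x t * (\<Sum>n. A n * of_real t ^ n)"
  have nz: "Gamma \<gamma> \<noteq> 0" "Gamma \<mu> \<noteq> 0" "(of_real x :: complex) powr (\<mu> + \<delta> - 1) \<noteq> 0"
    using assms Gamma_neq_0_of_Re_pos[of \<gamma>] Gamma_neq_0_of_Re_pos[of \<mu>] by simp_all
  have term_eq: "multiindex_bessel_term m \<alpha> \<beta> \<gamma> \<kappa> b c z = (\<lambda>n. A n * z ^ n)" for z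
    unfolding A_def by (rule ext) (rule multiindex_bessel_term_eq)
  \<comment> \<open>The order \<open>\<kappa> - 1 - (\<Sum>j=1..m. Re (\<alpha> j))\<close> is
    negative by the assumption on the sum.\<close>
  have summ: "summable (\<lambda>n. norm (A n * z ^ n))" for z
    using superexp_bound_summable[OF superexp_bound_multiindex_bessel_term[OF assms(1),
          where m = m and \<alpha> = \<alpha> and \<beta> = \<beta> and \<gamma> = \<gamma> and b = b and c = c and z = z]] assms(2)
    by (simp add: term_eq)
  \<comment> \<open>In the Beta value \<open>\<Gamma>(\<delta> + n) \<Gamma>(\<mu>) /
    \<Gamma>(\<delta> + n + \<mu>)\<close> the factor \<open>\<Gamma>(\<mu>)\<close> cancels against
    the prefactor of the fractional integral.\<close>
  have fw: "1 / Gamma \<mu> * (A n * (of_real x powr (\<delta> + of_nat n + \<mu> - 1) * Beta (\<delta> + of_nat n) \<mu>))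
      = of_real x powr (\<mu> + \<delta> - 1) / Gamma \<gamma> * ?fw n" for n
  proof -
    have "(of_real x :: complex) powr (\<delta> + of_nat n + \<mu> - 1) = of_real x powr (\<mu> + \<delta> - 1 + of_nat n)"
      by (simp add: algebra_simps)
    also have "\<dots> = of_real x powr (\<mu> + \<delta> - 1) * of_real x ^ n"
      using assms by (subst powr_add) (simp add: powr_nat)
    finally show ?thesis using nz
      unfolding fox_wright_term_eq[OF nz(1)] term_eq Beta_altdef
      by (simp add: add_ac)
  qed
  have fw_sums: "(\<lambda>n. of_real x powr (\<mu> + \<delta> - 1) / Gamma \<gamma> * ?fw n) sums (1 / Gamma \<mu> * ?I)"
    using sums_mult[OF sums_beta_kernel_powser[OF assms(6,5,7) summ], of "1 / Gamma \<mu>"]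
    by (simp only: fw)
  \<comment> \<open>Convergence of the Fox-Wright series is inherited from the integrated series,
    since the common prefactor is nonzero.\<close>
  then have summ_fw: "summable ?fw"
    using nz sums_summable[OF fw_sums] by (simp add: summable_cmult_iff)
  show ?thesis
  proof (intro conjI ballI)
    show "summable (multiindex_bessel_term m \<alpha> \<beta> \<gamma> \<kappa> b c (of_real t))" for t :: real
      unfolding term_eq by (rule summable_norm_cancel[OF summ])
    show "rl_integrable \<mu> (\<lambda>t. of_real t powr (\<delta> - 1) * multiindex_bessel m \<alpha> \<beta> \<gamma> \<kappa> b c (of_real t)) x"
      using set_integrable_beta_kernel_powser[OF assms(6,5,7) summ]
      by (simp add: rl_integrable_def rl_integrand_eq_beta_kernel multiindex_bessel_def term_eq
          cong: set_integrable_cong)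
    show "summable ?fw" by (rule summ_fw)
    have "rl_integral \<mu> (\<lambda>t. of_real t powr (\<delta> - 1) * multiindex_bessel m \<alpha> \<beta> \<gamma> \<kappa> b c (of_real t)) x
        = 1 / Gamma \<mu> * ?I"
      by (simp add: rl_integral_def rl_integrand_eq_beta_kernel multiindex_bessel_def term_eq)
    also have "\<dots> = (\<Sum>n. of_real x powr (\<mu> + \<delta> - 1) / Gamma \<gamma> * ?fw n)"
      using fw_sums by (rule sums_unique)
    also have "\<dots> = of_real x powr (\<mu> + \<delta> - 1) / Gamma \<gamma> * (\<Sum>n. ?fw n)"
      using summ_fw by (rule suminf_mult)
    finally show "rl_integral \<mu> (\<lambda>t. of_real t powr (\<delta> - 1) * multiindex_bessel m \<alpha> \<beta> \<gamma> \<kappa> b c (of_real t)) x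
        = of_real x powr (\<mu> + \<delta> - 1) / Gamma \<gamma> *
          fox_wright [(\<gamma>, of_real \<kappa>), (\<delta>, 1)]
            (map (\<lambda>j. (\<beta> j + (b + 1) / 2, \<alpha> j)) [1..<m+1] @ [(\<mu> + \<delta>, 1)]) (c * of_real x)"
      by (simp only: fox_wright_def)
  qed
qed

end
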